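(* Let $p>5$ be prime, $q=p^h$, $n>3$, and let $\mathcal{F}: aX^n+bY^n=Z^n$ be an irreducible Fermat curve over $\mathbb{F}_q$. Suppose $p$ divides $n+1$. Then $\mathcal{F}$ is $\mathbb{F}_q$-Frobenius nonclassical with respect to $\Sigma_2$ if and only if $a+b=1$ and $n=q-1$.
   Context: $\Sigma_2$ is the linear system of plane conics. The function field of $\mathcal{F}$ is $\overline{\mathbb{F}}_q(x,y)$ with $ax^n+by^n=1$; $t$ is a separating variable and $D_t^{(r)}$ the $r$-th Hasse derivative. The $\mathbb{F}_q$-Frobenius sequence $(\nu_0,\dots,\nu_4)$ of $\mathcal{F}$ w.r.t. $\Sigma_2$ is the lexicographically minimal increasing sequence of nonnegative integers such that the $6\times6$ determinant, with columns indexed by monomials $x^iy^j$ ($0\le i+j\le2$), first row $((x^iy^j)^q)$ and $(k+2)$-th row $(D_t^{(\nu_k)}(x^iy^j))$, is nonzero; $\mathcal{F}$ is $\mathbb{F}_q$-Frobenius nonclassical w.r.t. $\Sigma_2$ if $(\nu_0,\dots,\nu_4)\neq(0,1,2,3,4)$. *)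

theory Defs
  imports "Jordan_Normal_Form.Determinant" "HOL-Computational_Algebra.Polynomial_Factorial"
begin

definition is_alg_closure_Fp :: "nat \<Rightarrow> 'k::field itself \<Rightarrow> bool" where
  "is_alg_closure_Fp p _ \<longleftrightarrow>
     (of_nat p :: 'k) = 0 \<and>
     (\<forall>f :: 'k poly. degree f > 0 \<longrightarrow> (\<exists>z. poly f z = 0)) \<and>
     (\<forall>c :: 'k. \<exists>m>0. c ^ (p ^ m) = c)"

text \<open>Bivariate polynomials k[X,Y] as 'k poly poly (outer variable Y, coefficients in k[X]).
  The affine Fermat polynomial  b Y^n + (a X^n - 1).\<close>
definition fermat_poly :: "'k::field \<Rightarrow> 'k \<Rightarrow> nat \<Rightarrow> 'k poly poly" where
  "fermat_poly a b n = monom [:b:] n + [: monom a n - 1 :]"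

definition eval2 :: "('k::field \<Rightarrow> 'K::field) \<Rightarrow> 'K \<Rightarrow> 'K \<Rightarrow> 'k poly poly \<Rightarrow> 'K" where
  "eval2 \<iota> x y g = poly (map_poly (\<lambda>c. poly (map_poly \<iota> c) x) g) y"

text \<open>(K, iota, x, y) is the function field k(x,y) of the curve a x^n + b y^n = 1:
  iota is a field embedding of k, the kernel of g \<mapsto> g(x,y) is the ideal generated by the
  Fermat polynomial, and K is generated as a field by k, x, y (i.e. K is the fraction field
  of k[X,Y]/(a X^n + b Y^n - 1)).\<close>
definition fermat_function_field ::
  "('k::field \<Rightarrow> 'K::field) \<Rightarrow> 'k \<Rightarrow> 'k \<Rightarrow> nat \<Rightarrow> 'K \<Rightarrow> 'K \<Rightarrow> bool" where
  "fermat_function_field \<iota> a b n x y \<longleftrightarrow>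
     \<iota> 1 = 1 \<and> (\<forall>c d. \<iota> (c + d) = \<iota> c + \<iota> d) \<and> (\<forall>c d. \<iota> (c * d) = \<iota> c * \<iota> d) \<and>
     (\<forall>g. eval2 \<iota> x y g = 0 \<longleftrightarrow> fermat_poly a b n dvd g) \<and>
     (\<forall>z. \<exists>g h. eval2 \<iota> x y h \<noteq> 0 \<and> z = eval2 \<iota> x y g / eval2 \<iota> x y h)"

definition hasse_derivatives :: "('k::field \<Rightarrow> 'K::field) \<Rightarrow> 'K \<Rightarrow> (nat \<Rightarrow> 'K \<Rightarrow> 'K) \<Rightarrow> bool" where
  "hasse_derivatives \<iota> t D \<longleftrightarrow>
     (\<forall>u. D 0 u = u) \<and>
     (\<forall>r u v. D r (u + v) = D r u + D r v) \<and>
     (\<forall>r c. r > 0 \<longrightarrow> D r (\<iota> c) = 0) \<and>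
     (\<forall>r u v. D r (u * v) = (\<Sum>i\<le>r. D i u * D (r - i) v)) \<and>
     D 1 t = 1 \<and> (\<forall>r\<ge>2. D r t = 0)"

definition conic_monomials :: "(nat \<times> nat) list" where
  "conic_monomials = [(0,0), (1,0), (0,1), (2,0), (1,1), (0,2)]"

definition frobenius_matrix :: "nat \<Rightarrow> 'K::field \<Rightarrow> 'K \<Rightarrow> (nat \<Rightarrow> 'K \<Rightarrow> 'K) \<Rightarrow> nat list \<Rightarrow> 'K mat" where
  "frobenius_matrix q x y D \<nu> =
     mat 6 6 (\<lambda>(r, c). let m = x ^ fst (conic_monomials ! c) * y ^ snd (conic_monomials ! c)
                       in if r = 0 then m ^ q else D (\<nu> ! (r - 1)) m)"

definition admissible_seq :: "nat \<Rightarrow> 'K::field \<Rightarrow> 'K \<Rightarrow> (nat \<Rightarrow> 'K \<Rightarrow> 'K) \<Rightarrow> nat list \<Rightarrow> bool" where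
  "admissible_seq q x y D \<nu> \<longleftrightarrow>
     length \<nu> = 5 \<and> sorted_wrt (<) \<nu> \<and> det (frobenius_matrix q x y D \<nu>) \<noteq> 0"

definition lex_le5 :: "nat list \<Rightarrow> nat list \<Rightarrow> bool" where
  "lex_le5 \<nu> \<mu> \<longleftrightarrow> \<nu> = \<mu> \<or> (\<exists>k<5. (\<forall>i<k. \<nu> ! i = \<mu> ! i) \<and> \<nu> ! k < \<mu> ! k)"

definition frobenius_sequence :: "nat \<Rightarrow> 'K::field \<Rightarrow> 'K \<Rightarrow> (nat \<Rightarrow> 'K \<Rightarrow> 'K) \<Rightarrow> nat list \<Rightarrow> bool" where
  "frobenius_sequence q x y D \<nu> \<longleftrightarrow>
     admissible_seq q x y D \<nu> \<and> (\<forall>\<mu>. admissible_seq q x y D \<mu> \<longrightarrow> lex_le5 \<nu> \<mu>)"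

definition frobenius_nonclassical_conics :: "nat \<Rightarrow> 'K::field \<Rightarrow> 'K \<Rightarrow> (nat \<Rightarrow> 'K \<Rightarrow> 'K) \<Rightarrow> bool" where
  "frobenius_nonclassical_conics q x y D \<longleftrightarrow>
     (\<exists>\<nu>. frobenius_sequence q x y D \<nu> \<and> \<nu> \<noteq> [0, 1, 2, 3, 4])"

end

(* With n + 1 divisible by p, the functions A = a x^(n+1) and B = b y^(n+1) are p-th powers, so
   the Hasse derivatives of order 1, ..., p - 1 treat them as constants, while multiplying the
   equation of the curve by x y gives the conic A y + B x = x y.  This is the osculating conic: for
   X = x - A and Y = y - B it reads X Y = A B, so a conic meeting the branch to order 5 yields, after
   multiplication by X^2, a polynomial of degree at most 4 in X vanishing to order 5.  Hence the
   determinant for the orders 0, 1, 2, 3, 4 vanishes iff the Frobenius image (x^q, y^q) lies on this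
   conic, that is a x^(n+1-q) + b y^(n+1-q) = 1, which is impossible unless n + 1 = q.
   If n = q - 1, the q-th derivative does not annihilate the osculating conic; so the orders
   0, 1, 2, 3, 4, q give six independent rows, one of which can be exchanged for the Frobenius row.
   This shows that some sequence of orders is admissible. *)
theory Submission
  imports Defs "Jordan_Normal_Form.Char_Poly" "HOL-Computational_Algebra.Formal_Power_Series"
begin

section \<open>Power series vanishing to a given order, and uniqueness of the osculating
  conic\<close>

lemma fps_X_power_dvd_iff:
  fixes f :: "'a::field fps"
  shows "fps_X ^ m dvd f \<longleftrightarrow> (\<forall>i<m. fps_nth f i = 0)"
proof
  assume "fps_X ^ m dvd f"
  then obtain g where "f = fps_X ^ m * g" by (elim dvdE)
  then show "\<forall>i<m. fps_nth f i = 0" by (simp add: fps_X_power_mult_nth)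
next
  assume "\<forall>i<m. fps_nth f i = 0"
  then have "f = fps_X ^ m * fps_shift m f"
    by (auto simp: fps_eq_iff fps_X_power_mult_nth)
  then show "fps_X ^ m dvd f" by (rule dvdI)
qed

lemma poly_map_poly_pCons:
  assumes "f 0 = 0"
  shows "poly (map_poly f (pCons c P)) z = f c + z * poly (map_poly f P) z"
  using assms by (cases "c = 0 \<and> P = 0") (auto simp: map_poly_pCons)

lemma irreducible_poly_root_imp_degree:
  fixes P :: "'a::idom poly"
  assumes "irreducible P" and "poly P c = 0"
  shows "degree P \<le> 1"
proof -
  obtain Q where Q: "P = [:- c, 1:] * Q" using assms(2) by (metis dvdE poly_eq_0_iff_dvd)
  have "\<not> [:- c, 1:] dvd 1" by (auto simp: is_unit_poly_iff)
  with assms(1) Q have "Q dvd 1" using irreducibleD by blast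
  then have "degree Q = 0" by (auto simp: is_unit_poly_iff)
  then show ?thesis unfolding Q using degree_mult_le[of "[:- c, 1:]" Q] by simp
qed

text \<open>Each order of vanishing costs \<open>P\<close> a linear factor: the constant term
  \<open>z\<close> of \<open>Z\<close> is a root of \<open>P\<close>, and \<open>Z - z\<close> is
  \<open>fps_X\<close> times a unit, so cancelling the factor lowers the order by exactly one. A
  polynomial of degree below \<open>m\<close> runs out of factors.\<close>

lemma poly_at_fps_eq_0:
  fixes Z :: "'a::field fps"
  assumes Z: "fps_nth Z 1 \<noteq> 0"
    and "fps_X ^ m dvd poly (map_poly fps_const P) Z"
    and "P = 0 \<or> degree P < m"
  shows "P = 0"
  using assms(2,3)
proof (induction m arbitrary: P)
  case 0
  then show ?case by simp
next
  case (Suc m)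
  interpret c: map_poly_comm_ring_hom "fps_const :: 'a \<Rightarrow> 'a fps"
    by unfold_locales (auto simp: fps_const_add fps_const_mult)
  define z where "z = fps_nth Z 0"
  define U where "U = fps_shift 1 Z"
  have U: "fps_nth U 0 \<noteq> 0" using Z by (simp add: U_def)
  have ZU: "Z = fps_const z + fps_X * U"
    by (rule fps_ext) (auto simp: U_def z_def)
  have nth0: "fps_nth (poly (map_poly fps_const Q) Z) 0 = poly Q z" for Q
    by (induction Q) (auto simp: map_poly_pCons z_def)
  have "poly P z = 0"
    using Suc.prems(1) by (simp only: fps_X_power_dvd_iff) (simp flip: nth0)
  then obtain Q where Q: "P = [:- z, 1:] * Q" by (metis dvdE poly_eq_0_iff_dvd)
  have "poly (map_poly fps_const P) Z = fps_X * (U * poly (map_poly fps_const Q) Z)"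
    unfolding Q c.hom_mult
    by (simp add: map_poly_pCons ZU algebra_simps flip: fps_const_neg)
  with Suc.prems(1) have "fps_X ^ m dvd U * poly (map_poly fps_const Q) Z"
    by simp
  moreover have "is_unit U" using U by simp
  ultimately have "fps_X ^ m dvd poly (map_poly fps_const Q) Z"
    by (simp add: dvd_mult_unit_iff')
  moreover have "Q = 0 \<or> degree Q < m"
  proof (cases "Q = 0")
    case False
    then have "degree P = Suc (degree Q)" unfolding Q by (subst degree_mult_eq) auto
    with Suc.prems(2) False show ?thesis by auto
  qed simp
  ultimately have "Q = 0" by (rule Suc.IH)
  then show ?case using Q by simp
qed

text \<open>The coefficients of the quartic \<open>P\<close> are triangular in the unknowns: both
  ends give \<open>v5\<close> and \<open>v3\<close>, the linear and cubic ones then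
  \<open>v2\<close> and \<open>v1\<close>, the middle one \<open>v0\<close>. What remains is
  \<open>v4\<close> times the hyperbola X Y - A Y - B X.\<close>

lemma osculating_conic_unique:
  fixes X Y :: "'a::field fps"
  assumes hyp: "fps_X ^ 5 dvd (X - fps_const A) * (Y - fps_const B) - fps_const (A * B)"
    and X1: "fps_nth X 1 \<noteq> 0" and A: "A \<noteq> 0" and B: "B \<noteq> 0"
    and E: "fps_X ^ 5 dvd fps_const v0 + fps_const v1 * X + fps_const v2 * Y
       + fps_const v3 * X\<^sup>2 + fps_const v4 * (X * Y) + fps_const v5 * Y\<^sup>2"
  shows "v0 = 0 \<and> v1 = - (v4 * B) \<and> v2 = - (v4 * A) \<and> v3 = 0 \<and> v5 = 0"
proof -
  define Z where "Z = X - fps_const A"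
  define H where "H = Y - fps_const B"
  define C where "C = A * B"
  \<comment> \<open>Terms with a factor 2 are written as sums, so that \<open>fps_const\<close>
    distributes over them by its addition and multiplication rules alone.\<close>
  define P where "P = [:v5 * C * C, v2 * C + v4 * A * C + (v5 * B * C + v5 * B * C),
     v0 + v1 * A + v2 * B + v3 * A * A + v4 * (C + A * B) + v5 * B * B,
     v1 + (v3 * A + v3 * A) + v4 * B, v3:]"
  have XY: "X = Z + fps_const A" "Y = H + fps_const B" by (simp_all add: Z_def H_def)
  (* Z^2 times the conic, with every product Z H replaced by the constant C, is the quartic P in Z. *)
  have identity: "w5 * c * c + z * ((w2 * c + w4 * a * c + (w5 * b * c + w5 * b * c))
        + z * ((w0 + w1 * a + w2 * b + w3 * a * a + w4 * (c + a * b) + w5 * b * b)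
        + z * ((w1 + (w3 * a + w3 * a) + w4 * b) + z * w3))) =
      z\<^sup>2 * (w0 + w1 * (z + a) + w2 * (u + b) + w3 * (z + a)\<^sup>2 + w4 * ((z + a) * (u + b)) + w5 * (u + b)\<^sup>2)
      - (z * u - c) * (w2 * z + w4 * ((z + a) * z) + w5 * (z * u + c + 2 * b * z))"
    for w0 w1 w2 w3 w4 w5 z u a b c :: "'a fps"
    by (simp add: power2_eq_square algebra_simps)
  have "poly (map_poly fps_const P) Z =
      fps_const v5 * fps_const C * fps_const C + Z * ((fps_const v2 * fps_const C
        + fps_const v4 * fps_const A * fps_const C
        + (fps_const v5 * fps_const B * fps_const C + fps_const v5 * fps_const B * fps_const C))
        + Z * ((fps_const v0 + fps_const v1 * fps_const A + fps_const v2 * fps_const B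
            + fps_const v3 * fps_const A * fps_const A
            + fps_const v4 * (fps_const C + fps_const A * fps_const B)
            + fps_const v5 * fps_const B * fps_const B)
        + Z * ((fps_const v1 + (fps_const v3 * fps_const A + fps_const v3 * fps_const A)
            + fps_const v4 * fps_const B) + Z * fps_const v3)))"
    unfolding P_def by (simp only: poly_map_poly_pCons fps_const_0_eq_0
        map_poly_0 poly_0 mult_zero_right add_0_right fps_const_add[symmetric] fps_const_mult[symmetric])
  also have "\<dots> =
    Z\<^sup>2 * (fps_const v0 + fps_const v1 * X + fps_const v2 * Y
       + fps_const v3 * X\<^sup>2 + fps_const v4 * (X * Y) + fps_const v5 * Y\<^sup>2)
    - (Z * H - fps_const C) * (fps_const v2 * Z + fps_const v4 * ((Z + fps_const A) * Z)
       + fps_const v5 * (Z * H + fps_const C + 2 * fps_const B * Z))"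
    unfolding XY by (rule identity)
  finally have "poly (map_poly fps_const P) Z = \<dots>" .
  moreover have "fps_X ^ 5 dvd Z * H - fps_const C" using hyp by (simp add: Z_def H_def C_def)
  ultimately have "fps_X ^ 5 dvd poly (map_poly fps_const P) Z"
    using E by (metis dvd_diff dvd_mult dvd_mult2)
  moreover have "fps_nth Z 1 \<noteq> 0" using X1 by (simp add: Z_def)
  moreover have "P = 0 \<or> degree P < 5" by (auto simp: P_def)
  ultimately have "P = 0" by (intro poly_at_fps_eq_0)
  then have v5: "v5 = 0" and v3: "v3 = 0" and "v2 * C + v4 * A * C = 0" and v1: "v1 + v4 * B = 0"
    and v0: "v0 + v1 * A + v2 * B + v4 * (C + A * B) = 0"
    using A B by (auto simp: P_def C_def)
  then have "C * (v2 + v4 * A) = 0" by (simp add: algebra_simps)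
  then have v2: "v2 = - (v4 * A)" using A B by (simp add: C_def eq_neg_iff_add_eq_0)
  have v1': "v1 = - (v4 * B)" using v1 by (simp add: eq_neg_iff_add_eq_0)
  have "v0 = 0" using v0 by (simp add: v2 v1' C_def algebra_simps)
  then show ?thesis using v1' v2 v3 v5 by simp
qed

text \<open>Freshman's dream for the splitting of \<open>f\<close> into its constant term and
  \<open>fps_X\<close> times a series: the power pushes the nonconstant part to order
  \<open>m\<close>. With \<open>m = p\<close> it shows that low derivatives ignore p-th powers; with
  \<open>m = q\<close> it yields the exact coefficient at order \<open>q\<close>.\<close>

lemma fps_power_CHAR_power:
  fixes f :: "'a::field fps"
  assumes "prime CHAR('a)" and "m = CHAR('a) ^ j"
  shows "f ^ m = fps_const (fps_nth f 0 ^ m) + fps_X ^ m * fps_shift 1 f ^ m"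
proof -
  have "f = fps_const (fps_nth f 0) + fps_X * fps_shift 1 f"
    by (rule fps_ext) auto
  then have "f ^ m = (fps_const (fps_nth f 0) + fps_X * fps_shift 1 f) ^ m" by simp
  also have "\<dots> = fps_const (fps_nth f 0) ^ m + (fps_X * fps_shift 1 f) ^ m"
    using assms by (intro freshmans_dream'[where n = j]) auto
  finally show ?thesis by (simp add: power_mult_distrib fps_const_power)
qed

section \<open>Exchange of rows, lexicographic minima, and the determinant as a kernel
  condition\<close>

lemma row_exchange:
  fixes N :: "nat \<Rightarrow> nat \<Rightarrow> 'a::field" and r :: "nat \<Rightarrow> 'a"
  assumes inj: "\<And>v. \<forall>i<n. (\<Sum>j<n. N i j * v j) = 0 \<Longrightarrow> \<forall>j<n. v j = 0"
    and r: "k < n" "r k \<noteq> 0"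
  shows "\<exists>i<n. \<forall>v. (\<Sum>j<n. r j * v j) = 0 \<and> (\<forall>l<n. l \<noteq> i \<longrightarrow> (\<Sum>j<n. N l j * v j) = 0)
           \<longrightarrow> (\<forall>j<n. v j = 0)"
proof (rule ccontr)
  assume "\<not> ?thesis"
  \<comment> \<open>If no row can be exchanged, each \<open>i\<close> has a nonzero vector
    \<open>v i\<close> killed by \<open>r\<close> and by all rows of \<open>N\<close> except row
    \<open>i\<close>. Up to the scalars \<open>s i\<close>, these are the columns of the inverse of
    \<open>N\<close>, so they span everything and \<open>r\<close> would be zero.\<close>
  then have "\<forall>i. \<exists>v. i < n \<longrightarrow> (\<Sum>j<n. r j * v j) = 0 \<and>
      (\<forall>l<n. l \<noteq> i \<longrightarrow> (\<Sum>j<n. N l j * v j) = 0) \<and> (\<exists>j<n. v j \<noteq> 0)"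
    by blast
  from choice[OF this] obtain v where v: "\<And>i. i < n \<Longrightarrow> (\<Sum>j<n. r j * v i j) = 0"
      "\<And>i l. i < n \<Longrightarrow> l < n \<Longrightarrow> l \<noteq> i \<Longrightarrow> (\<Sum>j<n. N l j * v i j) = 0"
      "\<And>i. i < n \<Longrightarrow> \<exists>j<n. v i j \<noteq> 0"
    by blast
  define s where "s i = (\<Sum>j<n. N i j * v i j)" for i
  have s: "s i \<noteq> 0" if "i < n" for i
  proof
    assume "s i = 0"
    then have "\<forall>l<n. (\<Sum>j<n. N l j * v i j) = 0" using v(2)[OF that] by (auto simp: s_def)
    with inj[of "v i"] v(3)[OF that] show False by blast
  qed
  \<comment> \<open>With these coefficients, \<open>N\<close> maps the combination of the
    \<open>v i\<close> to column \<open>k\<close> of \<open>N\<close>. Hence \<open>w\<close>, its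
    difference from the k-th unit vector, lies in the trivial kernel.\<close>
  define \<alpha> where "\<alpha> i = N i k / s i" for i
  define e where "e j = (if j = k then 1 else 0 :: 'a)" for j
  define w where "w j = (\<Sum>i<n. \<alpha> i * v i j) - e j" for j
  have swap: "(\<Sum>j<n. g j * w j) = (\<Sum>i<n. \<alpha> i * (\<Sum>j<n. g j * v i j)) - g k" for g :: "nat \<Rightarrow> 'a"
  proof -
    have "(\<Sum>j<n. g j * w j) = (\<Sum>j<n. \<Sum>i<n. g j * (\<alpha> i * v i j)) - (\<Sum>j<n. g j * e j)"
      by (simp add: w_def right_diff_distrib sum_subtractf sum_distrib_left)
    also have "(\<Sum>j<n. g j * e j) = g k" using r(1) by (simp add: e_def if_distrib sum.delta cong: if_cong)
    also have "(\<Sum>j<n. \<Sum>i<n. g j * (\<alpha> i * v i j)) = (\<Sum>i<n. \<Sum>j<n. g j * (\<alpha> i * v i j))"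
      by (rule sum.swap)
    also have "\<dots> = (\<Sum>i<n. \<alpha> i * (\<Sum>j<n. g j * v i j))"
      by (simp add: sum_distrib_left mult_ac)
    finally show ?thesis .
  qed
  have "(\<Sum>j<n. N l j * w j) = 0" if l: "l < n" for l
  proof -
    have "(\<Sum>i<n. \<alpha> i * (\<Sum>j<n. N l j * v i j)) = (\<Sum>i<n. if i = l then \<alpha> l * s l else 0)"
      using l v(2) by (intro sum.cong) (auto simp: s_def)
    then show ?thesis using l s[OF l] by (simp add: swap \<alpha>_def)
  qed
  then have "\<forall>j<n. w j = 0" using inj by blast
  then have "(\<Sum>j<n. r j * w j) = 0" by simp
  then have "r k = 0" by (simp add: swap v(1))
  with r(2) show False by simp
qed

text \<open>The order \<open>lex less_than\<close> is well founded and compares lists of equal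
  length at their first difference. For lists of length 5, a minimal element for it is least for
  \<open>lex_le5\<close>, because the order on numbers is total.\<close>

lemma lex_le5_minimal_exists:
  assumes "\<mu>0 \<in> S" and len: "\<And>\<mu>. \<mu> \<in> S \<Longrightarrow> length \<mu> = 5"
  shows "\<exists>\<nu>\<in>S. \<forall>\<mu>\<in>S. lex_le5 \<nu> \<mu>"
proof -
  obtain \<nu> where \<nu>: "\<nu> \<in> S" "\<And>\<mu>. (\<mu>, \<nu>) \<in> lex less_than \<Longrightarrow> \<mu> \<notin> S"
    using wfE_min[OF wf_lex[OF wf_less_than] assms(1)] by metis
  have "lex_le5 \<nu> \<mu>" if \<mu>: "\<mu> \<in> S" for \<mu>
  proof (cases "\<nu> = \<mu>")
    case False
    have l: "length \<nu> = 5" "length \<mu> = 5" using len \<nu>(1) \<mu> by auto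
    with False have ex: "\<exists>k. k < 5 \<and> \<nu> ! k \<noteq> \<mu> ! k" by (auto simp: list_eq_iff_nth_eq)
    define k where "k = (LEAST k. k < 5 \<and> \<nu> ! k \<noteq> \<mu> ! k)"
    have k: "k < 5" "\<nu> ! k \<noteq> \<mu> ! k" using LeastI_ex[OF ex] by (auto simp: k_def)
    have eq: "\<nu> ! i = \<mu> ! i" if "i < k" for i
      using not_less_Least[of i "\<lambda>k. k < 5 \<and> \<nu> ! k \<noteq> \<mu> ! k"] that k(1) by (auto simp: k_def)
    have "\<not> \<mu> ! k < \<nu> ! k"
    proof
      assume less: "\<mu> ! k < \<nu> ! k"
      have "take k \<mu> = take k \<nu>" using l k(1) eq by (intro nth_equalityI) auto
      then have "\<mu> = take k \<nu> @ \<mu> ! k # drop (Suc k) \<mu>" "\<nu> = take k \<nu> @ \<nu> ! k # drop (Suc k) \<nu>"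
        using l k(1) by (metis id_take_nth_drop)+
      then have "(\<mu>, \<nu>) \<in> lex less_than"
        using l less unfolding lex_conv by (simp del: take_append) blast
      with \<nu>(2) \<mu> show False by blast
    qed
    with k eq show ?thesis unfolding lex_le5_def by (metis linorder_neqE_nat)
  qed (simp add: lex_le5_def)
  with \<nu>(1) show ?thesis by blast
qed

text \<open>Consequently no strictly increasing sequence of length 5 other than
  \<open>[0, 1, 2, 3, 4]\<close> itself can precede it lexicographically.\<close>

lemma strict_sorted_nth_ge:
  fixes \<nu> :: "nat list"
  assumes "sorted_wrt (<) \<nu>" "k < length \<nu>"
  shows "k \<le> \<nu> ! k"
  using assms(2)
proof (induction k)
  case (Suc k)
  then have "\<nu> ! k < \<nu> ! Suc k" using assms(1) by (simp add: sorted_wrt_iff_nth_less)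
  with Suc show ?case by simp
qed simp

text \<open>A kernel vector \<open>v\<close> is the coefficient vector of a conic: it passes through
  the Frobenius image of the generic point, and its derivatives of the orders in
  \<open>\<nu>\<close> vanish along the branch.\<close>

lemma det_frobenius_matrix_eq_0_iff:
  fixes x y :: "'a::field" and D :: "nat \<Rightarrow> 'a \<Rightarrow> 'a"
  defines "m \<equiv> \<lambda>j. x ^ fst (conic_monomials ! j) * y ^ snd (conic_monomials ! j)"
  shows "det (frobenius_matrix q x y D \<nu>) = 0 \<longleftrightarrow>
    (\<exists>v. (\<exists>j<6. v j \<noteq> 0) \<and> (\<Sum>j<6. m j ^ q * v j) = 0 \<and> (\<forall>i<5. (\<Sum>j<6. D (\<nu> ! i) (m j) * v j) = 0))"
    (is "_ \<longleftrightarrow> (\<exists>v. ?Q v)")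
proof -
  let ?M = "frobenius_matrix q x y D \<nu>"
  have M: "?M \<in> carrier_mat 6 6" by (simp add: frobenius_matrix_def)
  have entry: "vec_index (?M *\<^sub>v w) i =
      (if i = 0 then \<Sum>j<6. m j ^ q * vec_index w j else \<Sum>j<6. D (\<nu> ! (i - 1)) (m j) * vec_index w j)"
    if "i < 6" "w \<in> carrier_vec 6" for w i
    using that by (simp add: frobenius_matrix_def scalar_prod_def m_def Let_def lessThan_atLeast0)
  have zero: "?M *\<^sub>v w = 0\<^sub>v 6 \<longleftrightarrow> (\<Sum>j<6. m j ^ q * vec_index w j) = 0 \<and>
      (\<forall>i<5. (\<Sum>j<6. D (\<nu> ! i) (m j) * vec_index w j) = 0)" (is "?L \<longleftrightarrow> ?R")
    if w: "w \<in> carrier_vec 6" for w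
  proof
    assume L: ?L
    have "vec_index (?M *\<^sub>v w) 0 = 0" "\<And>i. i < 5 \<Longrightarrow> vec_index (?M *\<^sub>v w) (Suc i) = 0"
      using L by auto
    then show ?R using entry[OF _ w] by auto
  next
    assume R: ?R
    show ?L
    proof (rule eq_vecI)
      fix i :: nat assume i: "i < dim_vec (0\<^sub>v 6)"
      show "vec_index (?M *\<^sub>v w) i = vec_index (0\<^sub>v 6) i"
        using R i entry[OF _ w] by (cases i) auto
    qed (use M in auto)
  qed
  show ?thesis unfolding det_0_iff_vec_prod_zero_field[OF M]
  proof
    assume "\<exists>w. w \<in> carrier_vec 6 \<and> w \<noteq> 0\<^sub>v 6 \<and> ?M *\<^sub>v w = 0\<^sub>v 6"
    then obtain w where w: "w \<in> carrier_vec 6" "w \<noteq> 0\<^sub>v 6" "?M *\<^sub>v w = 0\<^sub>v 6" by blast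
    then have "\<exists>j<6. vec_index w j \<noteq> 0" by (auto simp: vec_eq_iff)
    with w zero[OF w(1)] have "?Q (vec_index w)" by auto
    then show "\<exists>v. ?Q v" by blast
  next
    assume "\<exists>v. ?Q v"
    then obtain v where v: "?Q v" by blast
    have "vec 6 v \<in> carrier_vec 6" by simp
    moreover have "vec 6 v \<noteq> 0\<^sub>v 6" using v by (auto simp: vec_eq_iff)
    moreover have "?M *\<^sub>v vec 6 v = 0\<^sub>v 6" using v by (subst zero) simp_all
    ultimately show "\<exists>w. w \<in> carrier_vec 6 \<and> w \<noteq> 0\<^sub>v 6 \<and> ?M *\<^sub>v w = 0\<^sub>v 6" by blast
  qed
qed

section \<open>The function field of a Fermat curve with p dividing n + 1\<close>

locale fermat_hasse =
  fixes p h n q :: nat and a b :: "'k::field" and \<iota> :: "'k \<Rightarrow> 'K::field"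
    and x y t :: 'K and D :: "nat \<Rightarrow> 'K \<Rightarrow> 'K"
  assumes p: "prime p" "p > 5" and q: "h \<ge> 1" "q = p ^ h" and n: "n > 3"
    and alg_closure: "is_alg_closure_Fp p TYPE('k)"
    and Fq: "a ^ q = a" "b ^ q = b"
    and irred: "irreducible (fermat_poly a b n)"
    and fun_field: "fermat_function_field \<iota> a b n x y"
    and hasse: "hasse_derivatives \<iota> t D"
    and p_dvd: "p dvd n + 1"
begin

lemma \<iota>_1: "\<iota> 1 = 1" and \<iota>_add: "\<iota> (c + d) = \<iota> c + \<iota> d" and \<iota>_mult: "\<iota> (c * d) = \<iota> c * \<iota> d"
  using fun_field by (auto simp: fermat_function_field_def)

lemma \<iota>_0: "\<iota> 0 = 0"
  using \<iota>_add[of 0 0] by (simp only: add_0_left add_cancel_right_right)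

lemma \<iota>_power: "\<iota> (c ^ m) = \<iota> c ^ m"
  by (induction m) (simp_all add: \<iota>_1 \<iota>_mult)

lemma \<iota>_of_nat: "\<iota> (of_nat m) = of_nat m"
  by (induction m) (simp_all add: \<iota>_0 \<iota>_1 \<iota>_add)

lemma \<iota>_diff: "\<iota> (c - d) = \<iota> c - \<iota> d"
  using \<iota>_add[of "c - d" d] by simp

lemma \<iota>_eq_0_iff: "\<iota> c = 0 \<longleftrightarrow> c = 0"
  using \<iota>_mult[of c "inverse c"] \<iota>_0 \<iota>_1 by (cases "c = 0") auto

lemma poly_map_poly_\<iota>_add:
  "poly (map_poly \<iota> (f + g)) z = poly (map_poly \<iota> f) z + poly (map_poly \<iota> g) z"
  by (induction f g rule: poly_induct2)
     (simp_all add: poly_map_poly_pCons \<iota>_0 \<iota>_add algebra_simps)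

lemma poly_map_poly_\<iota>_diff:
  "poly (map_poly \<iota> (f - g)) z = poly (map_poly \<iota> f) z - poly (map_poly \<iota> g) z"
  using poly_map_poly_\<iota>_add[of "f - g" g z] by simp

lemma poly_map_poly_\<iota>_1: "poly (map_poly \<iota> 1) z = 1"
  by (simp add: one_pCons poly_map_poly_pCons \<iota>_0 \<iota>_1)

lemma CHAR_K: "CHAR('K) = p"
proof -
  have "(of_nat p :: 'k) = 0" using alg_closure by (simp add: is_alg_closure_Fp_def)
  then have "(of_nat p :: 'K) = 0" using \<iota>_of_nat[of p] \<iota>_0 by simp
  then have "CHAR('K) dvd p" by (simp add: of_nat_eq_0_iff_char_dvd)
  moreover have "CHAR('K) \<noteq> 1"
    using of_nat_CHAR[where 'a='K] by (metis of_nat_1 zero_neq_one)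
  ultimately show ?thesis using p(1) by (metis prime_nat_iff)
qed

lemma fps_power_p: "f ^ p = fps_const (fps_nth f 0 ^ p) + fps_X ^ p * fps_shift 1 f ^ p"
  for f :: "'K fps"
  by (rule fps_power_CHAR_power[where j = 1]) (simp_all add: CHAR_K p)

lemma fps_power_q: "f ^ q = fps_const (fps_nth f 0 ^ q) + fps_X ^ q * fps_shift 1 f ^ q"
  for f :: "'K fps"
  by (rule fps_power_CHAR_power[where j = h]) (simp_all add: CHAR_K p q)

lemma degree_monom_minus_1: "degree (monom c m - 1) = m" if "c \<noteq> 0" "m > 0" for c :: 'k
  using degree_add_eq_left[of "- 1" "monom c m"] that by (simp add: degree_monom_eq)

lemma root_exists:
  assumes "c \<noteq> 0" "m > 0"
  obtains z :: 'k where "c * z ^ m = 1" "z \<noteq> 0"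
proof -
  have "degree (monom c m - 1) = m" using assms by (rule degree_monom_minus_1)
  then obtain z where "poly (monom c m - 1) z = 0"
    using alg_closure assms unfolding is_alg_closure_Fp_def by metis
  then have "c * z ^ m = 1" by (simp add: poly_monom)
  moreover from this assms have "z \<noteq> 0" by (auto simp: zero_power)
  ultimately show ?thesis using that by blast
qed

text \<open>Over an algebraically closed field, b Y^n - 1 with b nonzero and n > 1 has a root and so
  is reducible; with b = 0 as well, only a unit is left.\<close>

lemma a_nonzero: "a \<noteq> 0"
proof
  assume a: "a = 0"
  show False
  proof (cases "b = 0")
    case True
    then show False using irred a by (auto simp: fermat_poly_def irreducible_def)
  next
    case False
    then obtain z where z: "b * z ^ n = 1" using root_exists[of b n] n by auto
    have "degree (fermat_poly a b n) = n"
      using n False a by (auto simp: fermat_poly_def degree_add_eq_left degree_monom_eq)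
    moreover have "poly (fermat_poly a b n) [:z:] = 0"
      using a z by (simp add: fermat_poly_def poly_monom poly_const_pow mult.commute one_pCons)
    ultimately show False using irreducible_poly_root_imp_degree[OF irred] n by auto
  qed
qed

lemma b_nonzero: "b \<noteq> 0"
proof
  assume "b = 0"
  then have "irreducible (monom a n - 1)"
    using irred by (simp add: fermat_poly_def irreducible_const_poly_iff)
  moreover obtain z where "a * z ^ n = 1" using root_exists[OF a_nonzero, of n] n by auto
  then have "poly (monom a n - 1) z = 0" by (simp add: poly_monom)
  moreover have "degree (monom a n - 1) = n"
    using a_nonzero n by (simp add: degree_monom_minus_1)
  ultimately show False using irreducible_poly_root_imp_degree n by fastforce
qed

lemma eval2_pCons: "eval2 \<iota> x y (pCons c g) = poly (map_poly \<iota> c) x + y * eval2 \<iota> x y g"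
  unfolding eval2_def by (rule poly_map_poly_pCons) (simp add: \<iota>_0 map_poly_0)

lemma eval2_add: "eval2 \<iota> x y (f + g) = eval2 \<iota> x y f + eval2 \<iota> x y g"
proof (induction f g rule: poly_induct2)
  case 0 then show ?case by (simp add: eval2_def)
next
  case (pCons c f d g)
  then show ?case by (simp add: eval2_pCons poly_map_poly_\<iota>_add algebra_simps)
qed

lemma eval2_monom: "eval2 \<iota> x y (monom c m) = poly (map_poly \<iota> c) x * y ^ m"
  by (induction m) (auto simp: monom_0 monom_Suc eval2_pCons, auto simp: eval2_def)

lemma eval2_const: "eval2 \<iota> x y [:c:] = poly (map_poly \<iota> c) x"
  by (simp add: eval2_pCons) (simp add: eval2_def)

lemma poly_map_poly_\<iota>_monom: "poly (map_poly \<iota> (monom c m)) x = \<iota> c * x ^ m"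
  by (simp add: map_poly_monom poly_monom \<iota>_0)

lemma eval2_eq_0_iff: "eval2 \<iota> x y g = 0 \<longleftrightarrow> fermat_poly a b n dvd g"
  using fun_field by (simp add: fermat_function_field_def)

lemma eval2_fermat_poly: "eval2 \<iota> x y (fermat_poly a b m) = \<iota> a * x ^ m + \<iota> b * y ^ m - 1"
  unfolding fermat_poly_def eval2_add eval2_monom eval2_const poly_map_poly_\<iota>_diff
    poly_map_poly_\<iota>_monom poly_map_poly_\<iota>_1
  by (simp add: poly_map_poly_pCons \<iota>_0)

lemma fermat_equation: "\<iota> a * x ^ n + \<iota> b * y ^ n = 1"
  using eval2_eq_0_iff[of "fermat_poly a b n"] by (simp add: eval2_fermat_poly)

text \<open>Multiples of the Fermat polynomial vanish at the points (0, z) of the curve, where b z^n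
  = 1. This serves to refute relations between \<open>x\<close> and \<open>y\<close> by specialising
  X to 0.\<close>

lemma eval2_eq_0_imp_vanishes_on_Y_axis:
  assumes "eval2 \<iota> x y g = 0"
  obtains z where "z \<noteq> 0" "poly (poly g [:z:]) 0 = 0"
proof -
  obtain z where z: "b * z ^ n = 1" "z \<noteq> 0" using root_exists[OF b_nonzero, of n] n by auto
  obtain f where f: "g = fermat_poly a b n * f" using assms unfolding eval2_eq_0_iff by (elim dvdE)
  have "poly (poly (fermat_poly a b n) [:z:]) 0 = 0"
    using n z by (simp add: fermat_poly_def poly_monom zero_power)
  then show ?thesis using that[OF z(2)] by (simp add: f)
qed

text \<open>The degree is the one in Y, where the Fermat polynomial has degree \<open>n\<close>.
  This excludes relations between \<open>x\<close> and \<open>y\<close> of low degree in Y.\<close>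

lemma eval2_eq_0_imp_degree:
  assumes "eval2 \<iota> x y g = 0" "g \<noteq> 0"
  shows "n \<le> degree g"
proof -
  have "fermat_poly a b n dvd g" using assms by (simp add: eval2_eq_0_iff)
  then have "degree (fermat_poly a b n) \<le> degree g" using assms by (intro dvd_imp_degree_le)
  moreover have "degree (fermat_poly a b n) = n"
    using n b_nonzero by (simp add: fermat_poly_def degree_add_eq_left degree_monom_eq)
  ultimately show ?thesis by simp
qed

lemma x_nonzero: "x \<noteq> 0"
proof
  assume "x = 0"
  then have "eval2 \<iota> x y [:monom 1 1:] = 0"
    unfolding eval2_const poly_map_poly_\<iota>_monom by simp
  from eval2_eq_0_imp_degree[OF this] n show False by simp
qed

lemma y_nonzero: "y \<noteq> 0"
proof
  assume "y = 0"
  then have "eval2 \<iota> x y (monom 1 1) = 0"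
    unfolding eval2_monom by simp
  from eval2_eq_0_imp_degree[OF this] n show False by (simp add: degree_monom_eq)
qed

section \<open>The osculating conic and Taylor expansions along t\<close>

definition A where "A = \<iota> a * x ^ (n + 1)"
definition B where "B = \<iota> b * y ^ (n + 1)"

lemma AB_nonzero: "A \<noteq> 0" "B \<noteq> 0"
  using a_nonzero b_nonzero x_nonzero y_nonzero by (simp_all add: A_def B_def \<iota>_eq_0_iff)

lemma conic_equation: "A * y + B * x = x * y"
proof -
  have "A * y + B * x = (\<iota> a * x ^ n + \<iota> b * y ^ n) * (x * y)"
    by (simp add: A_def B_def algebra_simps)
  then show ?thesis by (simp add: fermat_equation)
qed

text \<open>The Taylor expansion with respect to \<open>t\<close>: additivity and the Leibniz rule
  say that it is a ring homomorphism, and vanishing of the derivatives of order below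
  \<open>m\<close> becomes divisibility by \<open>fps_X ^ m\<close>.\<close>

definition \<phi> :: "'K \<Rightarrow> 'K fps" where "\<phi> u = Abs_fps (\<lambda>r. D r u)"

lemma \<phi>_nth [simp]: "fps_nth (\<phi> u) r = D r u" by (simp add: \<phi>_def)

lemma D_0 [simp]: "D 0 u = u"
  using hasse by (simp add: hasse_derivatives_def)

lemma D_\<iota>: "r > 0 \<Longrightarrow> D r (\<iota> c) = 0"
  using hasse by (simp add: hasse_derivatives_def)

lemma \<phi>_mult: "\<phi> (u * v) = \<phi> u * \<phi> v"
  using hasse by (auto simp: fps_eq_iff fps_mult_nth hasse_derivatives_def atLeast0AtMost)

lemma \<phi>_add: "\<phi> (u + v) = \<phi> u + \<phi> v"
  using hasse by (auto simp: fps_eq_iff hasse_derivatives_def)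

lemma \<phi>_\<iota>: "\<phi> (\<iota> c) = fps_const (\<iota> c)"
  by (auto simp: fps_eq_iff D_\<iota>)

lemma \<phi>_1: "\<phi> 1 = 1"
  using \<phi>_\<iota>[of 1] by (simp add: \<iota>_1)

lemma D_one: "D r 1 = (if r = 0 then 1 else 0)"
  unfolding \<phi>_nth[symmetric] \<phi>_1 by simp

lemma \<phi>_power: "\<phi> (u ^ m) = \<phi> u ^ m"
  by (induction m) (auto simp: \<phi>_1 \<phi>_mult)

lemma \<phi>_conic_equation: "\<phi> A * \<phi> y + \<phi> B * \<phi> x = \<phi> x * \<phi> y"
  by (simp flip: \<phi>_mult \<phi>_add add: conic_equation)

text \<open>Since \<open>n + 1 = m * p\<close>, the power of \<open>u\<close> is the p-th power of
  \<open>u ^ m\<close>, whose expansion has no terms of orders 1 to p - 1.\<close>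

lemma p_power_const_mod: "fps_X ^ p dvd \<phi> (\<iota> c * u ^ (n + 1)) - fps_const (\<iota> c * u ^ (n + 1))"
proof -
  obtain m where m: "n + 1 = m * p" using p_dvd by (metis dvdE mult.commute)
  have "\<phi> (\<iota> c * u ^ (n + 1)) - fps_const (\<iota> c * u ^ (n + 1)) =
      fps_const (\<iota> c) * (\<phi> (u ^ m) ^ p - fps_const ((u ^ m) ^ p))"
    unfolding m \<phi>_mult \<phi>_\<iota> \<phi>_power power_mult
    by (simp add: algebra_simps flip: fps_const_mult)
  then show ?thesis unfolding fps_power_p[of "\<phi> (u ^ m)"] by simp
qed

lemma A_const_mod: "fps_X ^ p dvd \<phi> A - fps_const A"
  and B_const_mod: "fps_X ^ p dvd \<phi> B - fps_const B"
  using p_power_const_mod by (simp_all add: A_def B_def)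

text \<open>Expanding gives x y - A y - B x with \<open>A\<close> and \<open>B\<close> frozen as
  constants. Subtracting the exact conic equation leaves only the errors made in freezing them,
  which have order at least p > 5.\<close>

lemma hyperbola_mod:
  "fps_X ^ 5 dvd (\<phi> x - fps_const A) * (\<phi> y - fps_const B) - fps_const (A * B)"
proof -
  have "(\<phi> x - fps_const A) * (\<phi> y - fps_const B) - fps_const (A * B) =
      \<phi> x * \<phi> y - fps_const A * \<phi> y - fps_const B * \<phi> x"
    by (simp add: algebra_simps)
  also have "\<dots> = (\<phi> A - fps_const A) * \<phi> y + (\<phi> B - fps_const B) * \<phi> x"
    unfolding \<phi>_conic_equation[symmetric] by (simp add: algebra_simps)
  finally have "(\<phi> x - fps_const A) * (\<phi> y - fps_const B) - fps_const (A * B) = \<dots>" .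
  then have "fps_X ^ p dvd (\<phi> x - fps_const A) * (\<phi> y - fps_const B) - fps_const (A * B)"
    using A_const_mod B_const_mod by (simp add: dvd_add)
  moreover have "(fps_X ^ 5 :: 'K fps) dvd fps_X ^ p" using p by (intro le_imp_power_dvd) simp
  ultimately show ?thesis by (rule dvd_trans[rotated])
qed

lemma D_1_mult: "D (Suc 0) (u * v) = u * D (Suc 0) v + D (Suc 0) u * v"
proof -
  have "fps_nth (\<phi> (u * v)) 1 = fps_nth (\<phi> u * \<phi> v) 1" by (simp add: \<phi>_mult)
  then show ?thesis by (simp add: fps_mult_nth)
qed

lemma D_add: "D r (u + v) = D r u + D r v"
  using hasse by (simp add: hasse_derivatives_def)

lemma D_zero: "D r 0 = 0"
  using D_add[of r 0 0] by (simp only: add_0_left add_cancel_right_right)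

lemma D_1_conic: "(x - A) * D (Suc 0) y + (y - B) * D (Suc 0) x = 0"
proof -
  have "D (Suc 0) A = 0" "D (Suc 0) B = 0"
    using A_const_mod B_const_mod p unfolding fps_X_power_dvd_iff by force+
  moreover have "D (Suc 0) (A * y + B * x) = D (Suc 0) (x * y)" by (simp add: conic_equation)
  ultimately show ?thesis by (simp add: D_add D_1_mult algebra_simps)
qed

text \<open>Otherwise the tangent relation \<open>D_1_conic\<close> kills the derivative of
  \<open>y\<close> too, because \<open>x - A\<close> is nonzero. The first derivative then vanishes
  on all polynomials in \<open>x\<close> and \<open>y\<close>, hence on their quotient
  \<open>t\<close>, whose derivative is 1.\<close>

lemma D_1_x_nonzero: "D (Suc 0) x \<noteq> 0"
proof
  assume x1: "D (Suc 0) x = 0"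
  have "(x - A) * (y - B) = x * y - (A * y + B * x) + A * B" by (simp add: algebra_simps)
  also have "\<dots> = A * B" unfolding conic_equation by simp
  finally have "(x - A) * (y - B) = A * B" .
  then have "x - A \<noteq> 0" using AB_nonzero by auto
  moreover have "(x - A) * D (Suc 0) y = 0" using D_1_conic x1 by simp
  ultimately have y1: "D (Suc 0) y = 0" by simp
  have "D (Suc 0) (poly (map_poly \<iota> c) x) = 0" for c
    by (induction c) (simp_all add: poly_map_poly_pCons \<iota>_0 D_add D_1_mult D_\<iota> D_zero x1)
  then have ev: "D (Suc 0) (eval2 \<iota> x y g) = 0" for g
    by (induction g) (simp_all add: eval2_pCons D_add D_1_mult D_zero y1,
        simp add: eval2_def D_zero)
  obtain g f where f: "eval2 \<iota> x y f \<noteq> 0" and t: "t = eval2 \<iota> x y g / eval2 \<iota> x y f"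
    using fun_field unfolding fermat_function_field_def by blast
  have "D (Suc 0) (t * eval2 \<iota> x y f) = 0" using f ev by (simp add: t)
  then have "D (Suc 0) t = 0" using f by (simp add: D_1_mult ev)
  moreover have "D (Suc 0) t = 1" using hasse by (simp add: hasse_derivatives_def)
  ultimately show False by simp
qed

section \<open>The rows of derivatives of orders 0 to 4 and their kernel\<close>

definition mon :: "nat \<Rightarrow> 'K" where
  "mon j = x ^ fst (conic_monomials ! j) * y ^ snd (conic_monomials ! j)"

lemma list_0_to_4: "[0, 1, 2, 3, 4] = [0..<5::nat]"
  by (simp add: upt_rec)

lemma less_6_cases:
  fixes j :: nat
  assumes "j < 6"
  obtains "j = 0" | "j = 1" | "j = 2" | "j = 3" | "j = 4" | "j = 5"
  using assms by linarith

lemma sum_6: "(\<Sum>j<6. f j) = f 0 + f 1 + f 2 + f 3 + f 4 + f 5" for f :: "nat \<Rightarrow> 'K"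
  by (simp add: eval_nat_numeral)

lemma mon_simps: "mon 0 = 1" "mon 1 = x" "mon (Suc 0) = x" "mon 2 = y" "mon 3 = x\<^sup>2" "mon 4 = x * y" "mon 5 = y\<^sup>2"
  by (simp_all add: mon_def conic_monomials_def)

text \<open>The series \<open>E\<close> expands the conic with coefficients \<open>v\<close>, so the
  five sums are its first five coefficients. \<open>osculating_conic_unique\<close> gives one
  direction and \<open>hyperbola_mod\<close> the other.\<close>

lemma wronskian_kernel:
  "(\<forall>i<5. (\<Sum>j<6. D i (mon j) * v j) = 0) \<longleftrightarrow>
   v 0 = 0 \<and> v 1 = - (v 4 * B) \<and> v 2 = - (v 4 * A) \<and> v 3 = 0 \<and> v 5 = 0" (is "?L \<longleftrightarrow> ?R")
proof -
  define E where "E = fps_const (v 0) + fps_const (v 1) * \<phi> x + fps_const (v 2) * \<phi> y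
       + fps_const (v 3) * (\<phi> x)\<^sup>2 + fps_const (v 4) * (\<phi> x * \<phi> y) + fps_const (v 5) * (\<phi> y)\<^sup>2"
  have "fps_nth E i = (\<Sum>j<6. D i (mon j) * v j)" for i
    unfolding E_def sum_6 mon_simps \<phi>_mult[symmetric] \<phi>_power[symmetric]
    by (simp add: D_one mult.commute)
  then have "?L \<longleftrightarrow> fps_X ^ 5 dvd E" by (simp add: fps_X_power_dvd_iff)
  also have "\<dots> \<longleftrightarrow> ?R"
  proof
    assume "fps_X ^ 5 dvd E"
    then show ?R unfolding E_def
      using osculating_conic_unique[OF hyperbola_mod _ AB_nonzero] D_1_x_nonzero by simp
  next
    assume ?R
    then have "E = fps_const (v 4) * ((\<phi> x - fps_const A) * (\<phi> y - fps_const B) - fps_const (A * B))"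
      by (simp add: E_def algebra_simps flip: fps_const_mult fps_const_neg)
    then show "fps_X ^ 5 dvd E" using hyperbola_mod by simp
  qed
  finally show ?thesis .
qed

text \<open>The derivative rows leave the osculating conic as the only candidate up to a scalar, so
  the Frobenius row decides.\<close>

lemma det_first_derivatives_eq_0_iff:
  "det (frobenius_matrix q x y D [0, 1, 2, 3, 4]) = 0 \<longleftrightarrow> x ^ q * y ^ q = A * y ^ q + B * x ^ q"
  (is "?L \<longleftrightarrow> ?R")
proof -
  have nth: "[0, 1, 2, 3, 4] ! i = i" if "i < 5" for i :: nat
    unfolding list_0_to_4 using that by simp
  have "?L \<longleftrightarrow> (\<exists>v. (\<exists>j<6. v j \<noteq> 0) \<and> (\<Sum>j<6. mon j ^ q * v j) = 0 \<and>
      (\<forall>i<5. (\<Sum>j<6. D i (mon j) * v j) = 0))"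
    unfolding det_frobenius_matrix_eq_0_iff by (simp add: nth del: One_nat_def flip: mon_def)
  also have "\<dots> \<longleftrightarrow> ?R"
  proof
    assume "\<exists>v. (\<exists>j<6. v j \<noteq> 0) \<and> (\<Sum>j<6. mon j ^ q * v j) = 0 \<and>
      (\<forall>i<5. (\<Sum>j<6. D i (mon j) * v j) = 0)"
    then obtain v j where v: "j < 6" "v j \<noteq> 0" "(\<Sum>j<6. mon j ^ q * v j) = 0"
      and ker: "v 0 = 0 \<and> v 1 = - (v 4 * B) \<and> v 2 = - (v 4 * A) \<and> v 3 = 0 \<and> v 5 = 0"
      unfolding wronskian_kernel by blast
    have "v 4 \<noteq> 0"
    proof
      assume "v 4 = 0"
      with ker v(2) show False by (cases rule: less_6_cases[OF v(1)]) simp_all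
    qed
    moreover have "v 4 * (x ^ q * y ^ q - (A * y ^ q + B * x ^ q)) = 0"
      using v(3) ker unfolding sum_6 mon_simps by (simp add: algebra_simps)
    ultimately show ?R by simp
  next
    assume R: ?R
    \<comment> \<open>The coefficients of X Y - A Y - B X in the order of
      \<open>conic_monomials\<close>.\<close>
    define v where "v j = [0, - B, - A, 0, 1, 0] ! j" for j
    have "(\<Sum>j<6. mon j ^ q * v j) = 0"
      using R unfolding sum_6 mon_simps by (simp add: v_def algebra_simps)
    moreover have "\<exists>j<6. v j \<noteq> 0" by (rule exI[of _ 4]) (simp add: v_def)
    moreover have "\<forall>i<5. (\<Sum>j<6. D i (mon j) * v j) = 0"
      unfolding wronskian_kernel by (simp add: v_def)
    ultimately show "\<exists>v. (\<exists>j<6. v j \<noteq> 0) \<and> (\<Sum>j<6. mon j ^ q * v j) = 0 \<and>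
      (\<forall>i<5. (\<Sum>j<6. D i (mon j) * v j) = 0)" by blast
  qed
  finally show ?thesis .
qed

section \<open>The Frobenius image on the osculating conic, and the criterion\<close>

lemma q_gt_5: "q > 5"
  using self_le_power[of p h] p q by simp

text \<open>Cancelling powers of \<open>x\<close> and \<open>y\<close> leaves a relation whose
  exponent is the distance \<open>s\<close> between \<open>n + 1\<close> and \<open>q\<close>. If
  \<open>s\<close> is positive, the relation contradicts the Fermat polynomial; if it is zero, the
  relation is a + b = 1.\<close>

lemma frobenius_conic_iff:
  "x ^ q * y ^ q = A * y ^ q + B * x ^ q \<longleftrightarrow> a + b = 1 \<and> n = q - 1" (is "?L \<longleftrightarrow> ?R")
proof
  assume ?R
  then have "n + 1 = q" and ab: "\<iota> a + \<iota> b = 1" using q_gt_5 by (auto simp: \<iota>_1 simp flip: \<iota>_add)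
  have "A * y ^ q + B * x ^ q = (\<iota> a + \<iota> b) * (x ^ q * y ^ q)"
    unfolding A_def B_def \<open>n + 1 = q\<close> by (simp add: algebra_simps)
  then show ?L by (simp add: ab)
next
  assume L: ?L
  consider "n + 1 < q" | "n + 1 > q" | "n + 1 = q" by linarith
  then show ?R
  proof cases
    case 1
    define s where "s = q - (n + 1)"
    have s: "q = n + 1 + s" "s > 0" using 1 by (simp_all add: s_def)
    \<comment> \<open>The relation x^s y^s = a y^s + b x^s as a polynomial; at a point (0, z) it
      would give a z^s = 0.\<close>
    define g where "g = monom ([:a:] - monom 1 s) s + [:monom b s:]"
    have "x ^ (n + 1) * y ^ (n + 1) * (x ^ s * y ^ s) = x ^ (n + 1) * y ^ (n + 1) * (\<iota> a * y ^ s + \<iota> b * x ^ s)"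
      using L by (simp add: A_def B_def s(1) power_add algebra_simps)
    then have "x ^ s * y ^ s = \<iota> a * y ^ s + \<iota> b * x ^ s"
      using x_nonzero y_nonzero by simp
    then have "eval2 \<iota> x y g = 0"
      unfolding g_def eval2_add eval2_monom eval2_const poly_map_poly_\<iota>_diff poly_map_poly_\<iota>_monom
      by (simp add: poly_map_poly_pCons \<iota>_0 \<iota>_1 left_diff_distrib)
    then obtain z where "z \<noteq> 0" "poly (poly g [:z:]) 0 = 0"
      by (rule eval2_eq_0_imp_vanishes_on_Y_axis)
    then show ?thesis using s(2) a_nonzero by (simp add: g_def poly_monom zero_power)
  next
    case 2
    define s where "s = n + 1 - q"
    have s: "n + 1 = q + s" "s > 0" using 2 by (simp_all add: s_def)
    have "A * y ^ q + B * x ^ q = x ^ q * y ^ q * (\<iota> a * x ^ s + \<iota> b * y ^ s)"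
      unfolding A_def B_def s(1) by (simp add: power_add algebra_simps)
    then have "x ^ q * y ^ q * (\<iota> a * x ^ s + \<iota> b * y ^ s) = x ^ q * y ^ q * 1" using L by simp
    then have "\<iota> a * x ^ s + \<iota> b * y ^ s = 1"
      using x_nonzero y_nonzero by simp
    then have "eval2 \<iota> x y (fermat_poly a b s) = 0" by (simp add: eval2_fermat_poly)
    moreover have deg: "degree (fermat_poly a b s) = s"
      using s b_nonzero by (simp add: fermat_poly_def degree_add_eq_left degree_monom_eq)
    moreover have "fermat_poly a b s \<noteq> 0" using s deg by auto
    \<comment> \<open>A Fermat relation of exponent s = n + 1 - q is too short, because q > 1 makes
      s < n.\<close>
    ultimately have "n \<le> s" using eval2_eq_0_imp_degree by metis
    then show ?thesis using s q_gt_5 by simp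
  next
    case 3
    then have "x ^ q * y ^ q * 1 = x ^ q * y ^ q * (\<iota> a + \<iota> b)"
      using L unfolding A_def B_def by (simp add: algebra_simps)
    then have "\<iota> (a + b - 1) = 0"
      using x_nonzero y_nonzero by (simp add: \<iota>_add \<iota>_diff \<iota>_1)
    then have "a + b = 1" unfolding \<iota>_eq_0_iff by simp
    then show ?thesis using 3 by auto
  qed
qed

text \<open>Nonclassicality asks for a minimal sequence that exists, so when
  \<open>[0, 1, 2, 3, 4]\<close> fails some other sequence must be produced.\<close>

lemma admissible_exists:
  assumes nq: "n + 1 = q"
  shows "\<exists>\<nu>. admissible_seq q x y D \<nu>"
proof -
  \<comment> \<open>\<open>?W\<close> turns out below to be the q-th derivative of the osculating
    conic. Were it zero, comparison with the q-th power of \<open>D_1_conic\<close> would eliminate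
    the derivatives and leave x^N = y^N with N = (n - 1) q + 1, which fails at the points (0,
    z).\<close>
  have D_q: "\<iota> a * D (Suc 0) x ^ q * y + \<iota> b * D (Suc 0) y ^ q * x \<noteq> 0" (is "?W \<noteq> 0")
  proof
    assume W: "?W = 0"
    have e: "1 - \<iota> a * x ^ n = \<iota> b * y ^ n" "1 - \<iota> b * y ^ n = \<iota> a * x ^ n"
      by (simp_all flip: fermat_equation)
    have "x - A = (1 - \<iota> a * x ^ n) * x" "y - B = (1 - \<iota> b * y ^ n) * y"
      by (simp_all add: A_def B_def algebra_simps)
    then have "x - A = \<iota> b * y ^ n * x" "y - B = \<iota> a * x ^ n * y"
      by (simp_all only: e)
    then have "\<iota> b * y ^ n * x * D (Suc 0) y + \<iota> a * x ^ n * y * D (Suc 0) x = 0"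
      using D_1_conic by simp
    \<comment> \<open>Raising to the power \<open>q\<close> splits the sum by the freshman's dream
      and fixes \<open>a\<close> and \<open>b\<close>, which lie in the field of q elements.\<close>
    then have "(\<iota> b * y ^ n * x * D (Suc 0) y + \<iota> a * x ^ n * y * D (Suc 0) x) ^ q = 0"
      using q_gt_5 by (simp add: zero_power)
    also have "(\<iota> b * y ^ n * x * D (Suc 0) y + \<iota> a * x ^ n * y * D (Suc 0) x) ^ q =
        (\<iota> b * y ^ n * x * D (Suc 0) y) ^ q + (\<iota> a * x ^ n * y * D (Suc 0) x) ^ q"
      using p q by (intro freshmans_dream'[where n = h]) (simp_all add: CHAR_K)
    also have "\<dots> = \<iota> b * y ^ (n * q) * x ^ q * D (Suc 0) y ^ q + \<iota> a * x ^ (n * q) * y ^ q * D (Suc 0) x ^ q"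
      by (simp add: power_mult_distrib power_mult Fq flip: \<iota>_power)
    finally have e': "\<iota> b * y ^ (n * q) * x ^ q * D (Suc 0) y ^ q =
        - (\<iota> a * x ^ (n * q) * y ^ q * D (Suc 0) x ^ q)"
      by (simp only: eq_neg_iff_add_eq_0)
    have "x ^ q * y ^ (n * q) * ?W = \<iota> a * D (Suc 0) x ^ q * (x ^ q * y ^ (n * q) * y)
        + \<iota> b * y ^ (n * q) * x ^ q * D (Suc 0) y ^ q * x"
      by (simp add: algebra_simps)
    also have "\<dots> = \<iota> a * D (Suc 0) x ^ q * (x ^ q * y ^ (n * q) * y - x ^ (n * q) * y ^ q * x)"
      unfolding e' by (simp add: algebra_simps)
    finally have "x ^ q * y ^ (n * q) * y = x ^ (n * q) * y ^ q * x"
      using W a_nonzero D_1_x_nonzero by (simp add: \<iota>_eq_0_iff)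
    then have eq: "x ^ q * y ^ (n * q + 1) = x ^ (n * q + 1) * y ^ q" by (simp add: mult_ac)
    define N where "N = n * q + 1 - q"
    have "q \<le> n * q" using n by simp
    then have N: "n * q + 1 = q + N" "N > 0" unfolding N_def by linarith+
    have "x ^ q * y ^ q * y ^ N = x ^ q * y ^ q * x ^ N"
      using eq unfolding N(1) by (simp only: power_add mult_ac)
    then have "y ^ N = x ^ N" using x_nonzero y_nonzero by simp
    define g where "g = monom 1 N + [:0 - monom (1 :: 'k) N:]"
    have "eval2 \<iota> x y g = 0"
      using \<open>y ^ N = x ^ N\<close> unfolding g_def eval2_add eval2_monom eval2_const poly_map_poly_\<iota>_diff poly_map_poly_\<iota>_monom
        poly_map_poly_\<iota>_1
      by (simp add: \<iota>_1)
    then obtain z where "z \<noteq> 0" "poly (poly g [:z:]) 0 = 0"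
      by (rule eval2_eq_0_imp_vanishes_on_Y_axis)
    then show False using N(2) by (simp add: g_def poly_monom zero_power)
  qed
  define e where "e = [0, 1, 2, 3, 4, q]"
  have inj: "\<forall>j<6. v j = 0" if "\<forall>i<6. (\<Sum>j<6. D (e ! i) (mon j) * v j) = 0" for v
  proof -
    have "\<forall>i<5. (\<Sum>j<6. D i (mon j) * v j) = 0"
    proof (intro allI impI)
      fix i :: nat assume "i < 5"
      then have "([0, 1, 2, 3, 4] @ [q]) ! i = i" unfolding list_0_to_4 by (simp add: nth_append)
      then have "e ! i = i" by (simp add: e_def)
      then show "(\<Sum>j<6. D i (mon j) * v j) = 0" using that[rule_format, of i] \<open>i < 5\<close> by simp
    qed
    then have ker: "v 0 = 0 \<and> v 1 = - (v 4 * B) \<and> v 2 = - (v 4 * A) \<and> v 3 = 0 \<and> v 5 = 0"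
      by (simp only: wronskian_kernel)
    have "(\<Sum>j<6. D q (mon j) * v j) = 0" using that[rule_format, of 5] by (simp add: e_def)
    then have "v 4 * (D q (x * y) - A * D q y - B * D q x) = 0"
      using ker unfolding sum_6 mon_simps by (simp add: algebra_simps)
    moreover have "D q (x * y) - A * D q y - B * D q x = ?W"
    proof -
      \<comment> \<open>With n + 1 = q, \<open>A\<close> and \<open>B\<close> are constants times
        q-th powers, so their expansions are known exactly. The shifted series start with the first
        derivatives of \<open>x\<close> and \<open>y\<close>, whose q-th powers appear at order
        \<open>q\<close>.\<close>
      have A: "\<phi> A = fps_const A + fps_X ^ q * (fps_const (\<iota> a) * fps_shift 1 (\<phi> x) ^ q)"
        and B: "\<phi> B = fps_const B + fps_X ^ q * (fps_const (\<iota> b) * fps_shift 1 (\<phi> y) ^ q)"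
        unfolding A_def B_def nq \<phi>_mult \<phi>_power \<phi>_\<iota> fps_power_q[of "\<phi> x"] fps_power_q[of "\<phi> y"]
        by (simp_all add: algebra_simps flip: fps_const_mult)
      have "\<phi> (x * y) - fps_const A * \<phi> y - fps_const B * \<phi> x =
        fps_X ^ q * (fps_const (\<iota> a) * fps_shift 1 (\<phi> x) ^ q * \<phi> y
          + fps_const (\<iota> b) * fps_shift 1 (\<phi> y) ^ q * \<phi> x)"
        unfolding \<phi>_mult \<phi>_conic_equation[symmetric] A B by (simp add: algebra_simps)
      from arg_cong[OF this, of "\<lambda>f. fps_nth f q"] show ?thesis
        by (simp add: fps_X_power_mult_nth fps_power_zeroth)
    qed
    ultimately have "v 4 = 0" using D_q by simp
    show ?thesis
    proof (intro allI impI)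
      fix j :: nat assume "j < 6"
      then show "v j = 0" using ker \<open>v 4 = 0\<close> by (cases j rule: less_6_cases) simp_all
    qed
  qed
  \<comment> \<open>The Frobenius row has entry 1 at the constant monomial, which makes it eligible
    for the exchange.\<close>
  have "mon 0 ^ q \<noteq> 0" by (simp add: mon_simps)
  then obtain i where i: "i < 6" "\<And>v. (\<Sum>j<6. mon j ^ q * v j) = 0 \<Longrightarrow>
      (\<And>l. l < 6 \<Longrightarrow> l \<noteq> i \<Longrightarrow> (\<Sum>j<6. D (e ! l) (mon j) * v j) = 0) \<Longrightarrow> \<forall>j<6. v j = 0"
    using row_exchange[of 6 "\<lambda>i j. D (e ! i) (mon j)" 0 "\<lambda>j. mon j ^ q", OF inj] by auto
  \<comment> \<open>The orders left after dropping the exchanged row; they increase strictly because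
    \<open>q\<close> exceeds 4.\<close>
  define \<nu> where "\<nu> = map ((!) e) (filter (\<lambda>l. l \<noteq> i) [0, 1, 2, 3, 4, 5])"
  have \<nu>: "length \<nu> = 5 \<and> sorted_wrt (<) \<nu>"
    using q_gt_5 by (cases rule: less_6_cases[OF i(1)]) (simp_all add: \<nu>_def e_def)
  have entries: "\<exists>k<5. \<nu> ! k = e ! l" if "l < 6" "l \<noteq> i" for l
  proof -
    have "l \<in> set (filter (\<lambda>l. l \<noteq> i) [0, 1, 2, 3, 4, 5])"
      using that by (cases l rule: less_6_cases) simp_all
    then have "e ! l \<in> set \<nu>" unfolding \<nu>_def set_map by blast
    then show ?thesis using \<nu> by (metis in_set_conv_nth)
  qed
  have "det (frobenius_matrix q x y D \<nu>) \<noteq> 0"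
  proof
    assume "det (frobenius_matrix q x y D \<nu>) = 0"
    then obtain v where v: "\<exists>j<6. v j \<noteq> 0" "(\<Sum>j<6. mon j ^ q * v j) = 0"
        "\<And>k. k < 5 \<Longrightarrow> (\<Sum>j<6. D (\<nu> ! k) (mon j) * v j) = 0"
      unfolding det_frobenius_matrix_eq_0_iff mon_def[symmetric] by blast
    have "(\<Sum>j<6. D (e ! l) (mon j) * v j) = 0" if l: "l < 6" "l \<noteq> i" for l
    proof -
      obtain k where "k < 5" "\<nu> ! k = e ! l" using entries[OF l] by blast
      with v(3)[of k] show ?thesis by simp
    qed
    then have "\<forall>j<6. v j = 0" by (rule i(2)[OF v(2)])
    with v(1) show False by blast
  qed
  with \<nu> show ?thesis unfolding admissible_seq_def by blast
qed

text \<open>As \<open>[0, 1, 2, 3, 4]\<close> comes first among increasing sequences, a different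
  minimum forces its determinant to vanish. Conversely, when that determinant vanishes,
  \<open>admissible_exists\<close> and well-foundedness supply a different minimum.\<close>

lemma nonclassical_iff:
  "frobenius_nonclassical_conics q x y D \<longleftrightarrow> (a + b = 1 \<and> n = q - 1)"
proof
  assume "frobenius_nonclassical_conics q x y D"
  then obtain \<nu> where \<nu>: "admissible_seq q x y D \<nu>" "\<nu> \<noteq> [0, 1, 2, 3, 4]"
    and min: "\<And>\<mu>. admissible_seq q x y D \<mu> \<Longrightarrow> lex_le5 \<nu> \<mu>"
    by (auto simp: frobenius_nonclassical_conics_def frobenius_sequence_def)
  have nth: "[0, 1, 2, 3, 4] ! i = i" if "i < 5" for i :: nat
    unfolding list_0_to_4 using that by simp
  have "\<not> lex_le5 \<nu> [0, 1, 2, 3, 4]"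
  proof
    assume "lex_le5 \<nu> [0, 1, 2, 3, 4]"
    then obtain k where "k < 5" "\<nu> ! k < k" using \<nu>(2) nth by (metis lex_le5_def)
    moreover have "k \<le> \<nu> ! k" using \<nu>(1) \<open>k < 5\<close>
      by (intro strict_sorted_nth_ge) (auto simp: admissible_seq_def)
    ultimately show False by simp
  qed
  then have "det (frobenius_matrix q x y D [0, 1, 2, 3, 4]) = 0"
    using min[of "[0, 1, 2, 3, 4]"] by (auto simp: admissible_seq_def)
  then show "a + b = 1 \<and> n = q - 1"
    by (simp only: det_first_derivatives_eq_0_iff frobenius_conic_iff)
next
  assume R: "a + b = 1 \<and> n = q - 1"
  then have "n + 1 = q" using q_gt_5 by simp
  then obtain \<mu>0 where "admissible_seq q x y D \<mu>0" using admissible_exists by blast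
  then obtain \<nu> where \<nu>: "admissible_seq q x y D \<nu>" "\<And>\<mu>. admissible_seq q x y D \<mu> \<Longrightarrow> lex_le5 \<nu> \<mu>"
    using lex_le5_minimal_exists[of \<mu>0 "Collect (admissible_seq q x y D)"]
    by (auto simp: admissible_seq_def)
  moreover have "det (frobenius_matrix q x y D [0, 1, 2, 3, 4]) = 0"
    using R det_first_derivatives_eq_0_iff frobenius_conic_iff by blast
  then have "\<not> admissible_seq q x y D [0, 1, 2, 3, 4]"
    unfolding admissible_seq_def by blast
  ultimately show "frobenius_nonclassical_conics q x y D"
    unfolding frobenius_nonclassical_conics_def frobenius_sequence_def by blast
qed

end

theorem theoremB1:
  fixes p h n q :: nat and a b :: "'k::field" and \<iota> :: "'k \<Rightarrow> 'K::field"
    and x y t :: 'K and D :: "nat \<Rightarrow> 'K \<Rightarrow> 'K"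
  assumes "prime p" and "p > 5" and "h \<ge> 1" and "q = p ^ h" and "n > 3"
    and "is_alg_closure_Fp p TYPE('k)"
    and "a ^ q = a" and "b ^ q = b"
    and "irreducible (fermat_poly a b n)"
    and "fermat_function_field \<iota> a b n x y"
    and "hasse_derivatives \<iota> t D"
    and "p dvd n + 1"
  shows "frobenius_nonclassical_conics q x y D \<longleftrightarrow> (a + b = 1 \<and> n = q - 1)"
proof -
  interpret fermat_hasse p h n q a b \<iota> x y t D
    using assms by unfold_locales
  show ?thesis by (rule nonclassical_iff)
qed

end
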